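(* Let $f:\operatorname{dom}(f)\subseteq\mathbb{R}^n\to\mathbb{R}$ and $g:\operatorname{dom}(g)\subseteq\mathbb{R}^n\to\mathbb{R}$, and let $\mathcal{X}=\langle x^0,x^0+d^1,\ldots,x^0+d^m\rangle$ be an ordered set of $m+1$ distinct points such that $\mathcal{X}\cup\mathcal{X}^-$ is contained in $\operatorname{dom}(f)$ and in $\operatorname{dom}(g)$. Then $$\nabla^c(fg)(\mathcal{X})=f(x^0)\nabla^c g(\mathcal{X})+g(x^0)\nabla^c f(\mathcal{X})+E^c_{fg}(\mathcal{X}),$$ where $E^c_{fg}(\mathcal{X})=\tfrac12\left(E^s_{fg}(\mathcal{X})+E^s_{fg}(\mathcal{X}^-)\right)$ and, for $\mathcal{Z}\in\{\mathcal{X},\mathcal{X}^-\}$, $E^s_{fg}(\mathcal{Z})=(S(\mathcal{Z})^\top)^\dagger\,\delta^s_{f|g}(\mathcal{Z})$.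
   Context: $A^\dagger$ denotes the Moore--Penrose pseudoinverse of a matrix $A$. For an ordered set $\mathcal{Z}=\langle z^0,z^0+e^1,\ldots,z^0+e^m\rangle$ in $\mathbb{R}^n$ put $S(\mathcal{Z})=[e^1\ \cdots\ e^m]\in\mathbb{R}^{n\times m}$ and $\mathcal{Z}^-=\langle z^0,z^0-e^1,\ldots,z^0-e^m\rangle$ (so $S(\mathcal{Z}^-)=-S(\mathcal{Z})$). The generalized centred simplex gradient of a real-valued function $h$ over $\mathcal{Z}$ is $\nabla^c h(\mathcal{Z})=(S(\mathcal{Z})^\top)^\dagger\delta^c_h(\mathcal{Z})$, where $\delta^c_h(\mathcal{Z})\in\mathbb{R}^m$ has $i$-th entry $\tfrac12\big(h(z^0+e^i)-h(z^0-e^i)\big)$. The product difference vector $\delta^s_{f|g}(\mathcal{Z})\in\mathbb{R}^m$ has $i$-th entry $\big(f(z^0+e^i)-f(z^0)\big)\big(g(z^0+e^i)-g(z^0)\big)$. *)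

theory Defs
  imports "HOL-Analysis.Analysis"
begin

definition penrose :: "real^'n^'m \<Rightarrow> real^'m^'n \<Rightarrow> bool" where
  "penrose A B \<longleftrightarrow>
     A ** B ** A = A \<and> B ** A ** B = B \<and>
     transpose (A ** B) = A ** B \<and> transpose (B ** A) = B ** A"

text \<open>The Moore--Penrose pseudoinverse is the unique solution of the four Penrose equations;
  existence and uniqueness are proved below.\<close>

definition pinv :: "real^'n^'m \<Rightarrow> real^'m^'n" where
  "pinv A = (THE B. penrose A B)"

lemma penrose_unique:
  assumes "penrose A B" "penrose A C"
  shows "B = C"
proof -
  have b: "A ** B ** A = A" "B ** A ** B = B" "transpose (A ** B) = A ** B" "transpose (B ** A) = B ** A"
    and c: "A ** C ** A = A" "C ** A ** C = C" "transpose (A ** C) = A ** C" "transpose (C ** A) = C ** A"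
    using assms by (auto simp: penrose_def)
  have "A ** B = A ** C ** (A ** B)"
    using c(1) by (simp add: matrix_mul_assoc)
  then have "A ** B = transpose (A ** C ** (A ** B))"
    using b(3) by simp
  also have "\<dots> = A ** B ** (A ** C)" by (simp only: matrix_transpose_mul[of "A ** C"] b c)
  also have "\<dots> = A ** C" using b(1) by (simp add: matrix_mul_assoc)
  finally have AB: "A ** B = A ** C" .
  have "B ** A = B ** A ** (C ** A)"
    using c(1) by (simp add: matrix_mul_assoc[symmetric])
  then have "B ** A = transpose (B ** A ** (C ** A))"
    using b(4) by simp
  also have "\<dots> = C ** A ** (B ** A)" by (simp only: matrix_transpose_mul[of "B ** A"] b c)
  also have "\<dots> = C ** A" using b(1) by (simp add: matrix_mul_assoc[symmetric])
  finally have BA: "B ** A = C ** A" .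
  show ?thesis by (metis AB BA b(2) c(2) matrix_mul_assoc)
qed

lemma transpose_eq_selfI:
  fixes M :: "real^'n^'n"
  assumes "\<And>x y. (M *v x) \<bullet> y = x \<bullet> (M *v y)"
  shows "transpose M = M"
proof -
  have "(transpose M *v x) \<bullet> y = (M *v x) \<bullet> y" for x y
    by (simp add: assms dot_lmul_matrix)
  then have "transpose M *v x = M *v x" for x
    by (metis vector_eq_rdot)
  then show ?thesis by (simp add: matrix_eq)
qed

lemma penrose_exists:
  fixes A :: "real^'n^'m"
  shows "\<exists>B. penrose A B"
proof -
  define R where "R y w \<longleftrightarrow> (\<forall>k. A *v k = 0 \<longrightarrow> k \<bullet> w = 0) \<and> (\<forall>v. (y - A *v w) \<bullet> (A *v v) = 0)"
    for y w
  have ex: "\<exists>w. R y w" for y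
  proof -
    obtain p z where p: "p \<in> span (range ((*v) A))"
      and z: "\<And>v. v \<in> span (range ((*v) A)) \<Longrightarrow> orthogonal z v" and y: "y = p + z"
      using orthogonal_subspace_decomp_exists[of "range ((*v) A)" y] by metis
    have "span (range ((*v) A)) = range ((*v) A)"
      by (intro span_eq_iff[THEN iffD2] linear_subspace_image subspace_UNIV) simp
    with p obtain u where u: "p = A *v u" by auto
    obtain k w where k: "k \<in> span {k. A *v k = 0}"
      and w: "\<And>v. v \<in> span {k. A *v k = 0} \<Longrightarrow> orthogonal w v" and uw: "u = k + w"
      using orthogonal_subspace_decomp_exists[of "{k. A *v k = 0}" u] by metis
    have "subspace {k. A *v k = 0}"
      by (auto simp: subspace_def matrix_vector_right_distrib matrix_vector_mult_scaleR)
    then have "A *v k = 0" using k by (simp add: span_eq_iff[THEN iffD2])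
    then have "A *v w = p" by (simp add: u uw matrix_vector_right_distrib)
    moreover have "z \<bullet> (A *v v) = 0" for v
      using z[of "A *v v"] by (simp add: orthogonal_def span_base)
    moreover have "k' \<bullet> w = 0" if "A *v k' = 0" for k'
      using w[of k'] that by (simp add: orthogonal_def span_base inner_commute)
    ultimately have "R y w" by (simp add: R_def y)
    then show ?thesis ..
  qed
  have un: "w = w'" if "R y w" "R y w'" for y w w'
  proof -
    have "(A *v (w - w')) \<bullet> (A *v (w - w')) = 0"
    proof -
      have "(y - A *v w) \<bullet> (A *v (w - w')) = 0" "(y - A *v w') \<bullet> (A *v (w - w')) = 0"
        using that by (auto simp: R_def)
      then show ?thesis
        unfolding matrix_vector_mult_diff_distrib[of A w w'] by (simp add: inner_diff_left)
    qed
    then have "A *v (w - w') = 0" by simp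
    then have "(w - w') \<bullet> (w - w') = 0"
      using that by (auto simp: R_def inner_diff_right)
    then show ?thesis by simp
  qed
  define g where "g y = (THE w. R y w)" for y
  have g: "R y (g y)" for y unfolding g_def by (rule theI') (use ex un in blast)
  have gI: "g y = w" if "R y w" for y w using g un that by blast
  have "linear g"
  proof (rule linearI)
    fix x y show "g (x + y) = g x + g y"
      using g[of x] g[of y]
      by (intro gI) (simp add: R_def inner_add_right matrix_vector_right_distrib
          add_diff_add inner_add_left)
  next
    fix c x show "g (c *\<^sub>R x) = c *\<^sub>R g x"
      using g[of x]
      by (intro gI) (simp add: R_def matrix_vector_mult_scaleR scaleR_diff_right[symmetric])
  qed
  then have mg: "matrix g *v y = g y" for y by (simp add: matrix_works)
  have o: "(y - A *v g y) \<bullet> (A *v v) = 0" "A *v k = 0 \<Longrightarrow> k \<bullet> g y = 0" for y v k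
    using g[of y] by (auto simp: R_def)
  have AgA: "A *v g (A *v v) = A *v v" for v
  proof -
    have "(A *v v - A *v g (A *v v)) \<bullet> (A *v (v - g (A *v v))) = 0" by (rule o)
    then show ?thesis by (simp add: matrix_vector_mult_diff_distrib)
  qed
  have gAg: "g (A *v g y) = g y" for y
    by (rule gI) (use o in \<open>auto simp: R_def\<close>)
  have "penrose A (matrix g)"
    unfolding penrose_def
  proof (intro conjI)
    show "A ** matrix g ** A = A" "matrix g ** A ** matrix g = matrix g"
      by (simp_all add: matrix_eq matrix_vector_mul_assoc[symmetric] mg AgA gAg)
    show "transpose (A ** matrix g) = A ** matrix g"
    proof (rule transpose_eq_selfI)
      fix x y
      have "(A *v g x) \<bullet> y = (A *v g x) \<bullet> (A *v g y)"
        using o(1)[of y "g x"] by (simp add: inner_diff_right inner_commute)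
      also have "\<dots> = x \<bullet> (A *v g y)"
        using o(1)[of x "g y"] by (simp add: inner_diff_left)
      finally show "(A ** matrix g *v x) \<bullet> y = x \<bullet> (A ** matrix g *v y)"
        by (simp add: matrix_vector_mul_assoc[symmetric] mg)
    qed
    show "transpose (matrix g ** A) = matrix g ** A"
    proof (rule transpose_eq_selfI)
      fix x y
      have k: "A *v (v - g (A *v v)) = 0" for v
        by (simp add: matrix_vector_mult_diff_distrib AgA)
      have "g (A *v x) \<bullet> y = g (A *v x) \<bullet> g (A *v y)"
        using o(2)[OF k[of y], of "A *v x"] by (simp add: inner_diff_right inner_commute)
      also have "\<dots> = x \<bullet> g (A *v y)"
        using o(2)[OF k[of x], of "A *v y"] by (simp add: inner_diff_left)
      finally show "(matrix g ** A *v x) \<bullet> y = x \<bullet> (matrix g ** A *v y)"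
        by (simp add: matrix_vector_mul_assoc[symmetric] mg)
    qed
  qed
  then show ?thesis ..
qed

lemma penrose_pinv: "penrose A (pinv A)"
  unfolding pinv_def by (rule theI') (use penrose_exists penrose_unique in blast)

text \<open>An ordered set \<open>\<langle>z0, z0 + e 1, \<dots>, z0 + e m\<rangle>\<close> is represented by its reference point
  and its family of directions, \<open>(z0, e)\<close>; \<open>m\<close> is the cardinality of the index type \<open>'m\<close>.\<close>

type_synonym ('n, 'm) ordset = "(real^'n) \<times> ('m \<Rightarrow> real^'n)"

definition points :: "('n::finite, 'm::finite) ordset \<Rightarrow> (real^'n) set" where
  "points Z = insert (fst Z) (range (\<lambda>i. fst Z + snd Z i))"

definition reflect :: "('n::finite, 'm::finite) ordset \<Rightarrow> ('n, 'm) ordset" where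
  "reflect Z = (fst Z, \<lambda>i. - snd Z i)"

definition dir_mat :: "('n::finite, 'm::finite) ordset \<Rightarrow> real^'m^'n" where
  "dir_mat Z = (\<chi> i j. snd Z j $ i)"

definition centred_diff :: "(real^'n \<Rightarrow> real) \<Rightarrow> ('n::finite, 'm::finite) ordset \<Rightarrow> real^'m" where
  "centred_diff h Z = (\<chi> i. 1/2 * (h (fst Z + snd Z i) - h (fst Z - snd Z i)))"

definition centred_simplex_grad ::
    "(real^'n \<Rightarrow> real) \<Rightarrow> ('n::finite, 'm::finite) ordset \<Rightarrow> real^'n" where
  "centred_simplex_grad h Z = pinv (transpose (dir_mat Z)) *v centred_diff h Z"

definition prod_diff ::
    "(real^'n \<Rightarrow> real) \<Rightarrow> (real^'n \<Rightarrow> real) \<Rightarrow> ('n::finite, 'm::finite) ordset \<Rightarrow> real^'m" where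
  "prod_diff f g Z =
     (\<chi> i. (f (fst Z + snd Z i) - f (fst Z)) * (g (fst Z + snd Z i) - g (fst Z)))"

definition simplex_prod_err ::
    "(real^'n \<Rightarrow> real) \<Rightarrow> (real^'n \<Rightarrow> real) \<Rightarrow> ('n::finite, 'm::finite) ordset \<Rightarrow> real^'n" where
  "simplex_prod_err f g Z = pinv (transpose (dir_mat Z)) *v prod_diff f g Z"

definition centred_prod_err ::
    "(real^'n \<Rightarrow> real) \<Rightarrow> (real^'n \<Rightarrow> real) \<Rightarrow> ('n::finite, 'm::finite) ordset \<Rightarrow> real^'n" where
  "centred_prod_err f g Z =
     (1/2) *\<^sub>R (simplex_prod_err f g Z + simplex_prod_err f g (reflect Z))"

end

theory Submission
  imports Defs
begin

text \<open>
  Reflecting the ordered set negates the direction matrix, and the pseudoinverse is odd, so both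
  error terms are images under the single linear map \<open>pinv (transpose (dir_mat X))\<close>, with
  opposite signs. The theorem is therefore the image under that map of an identity in
  \<open>\<real>\<^sup>m\<close>, which comes from the discrete product rule
  \<open>f(x\<^sub>0 + v) g(x\<^sub>0 + v) - f(x\<^sub>0) g(x\<^sub>0) = f(x\<^sub>0) \<Delta>g + g(x\<^sub>0) \<Delta>f + \<Delta>f \<Delta>g\<close>
  by subtracting its instance at \<open>v = - d i\<close> from the one at \<open>v = d i\<close> and halving; the
  value at the reference point cancels.
\<close>

lemma matrix_mult_minus_left: "(- A) ** B = - (A ** B)"
  for A :: "'a::ring_1^'n^'m" and B :: "'a^'p^'n"
  by (simp add: matrix_matrix_mult_def vec_eq_iff sum_negf)

lemma matrix_mult_minus_right: "A ** (- B) = - (A ** B)"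
  for A :: "'a::ring_1^'n^'m" and B :: "'a^'p^'n"
  by (simp add: matrix_matrix_mult_def vec_eq_iff sum_negf)

lemma matrix_vector_mult_minus_left: "(- A) *v x = - (A *v x)"
  for A :: "'a::ring_1^'n^'m" and x :: "'a^'n"
  by (simp add: matrix_vector_mult_def vec_eq_iff sum_negf)

lemma transpose_minus: "transpose (- A) = - transpose A"
  for A :: "'a::ring_1^'n^'m"
  by (simp add: transpose_def vec_eq_iff)

text \<open>In each Penrose equation the numbers of factors on the two sides have the same parity, so the
  equations survive a simultaneous change of sign of both matrices.\<close>

lemma pinv_minus: "pinv (- A) = - pinv A"
  for A :: "real^'n^'m"
proof (rule penrose_unique)
  show "penrose (- A) (pinv (- A))"
    by (rule penrose_pinv)
  show "penrose (- A) (- pinv A)"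
    using penrose_pinv[of A]
    by (simp add: penrose_def matrix_mult_minus_left matrix_mult_minus_right)
qed

lemma dir_mat_reflect: "dir_mat (reflect Z) = - dir_mat Z"
  by (simp add: dir_mat_def reflect_def vec_eq_iff)

lemma simplex_prod_err_reflect:
  "simplex_prod_err f g (reflect Z) =
     - (pinv (transpose (dir_mat Z)) *v prod_diff f g (reflect Z))"
  by (simp add: simplex_prod_err_def dir_mat_reflect transpose_minus pinv_minus
      matrix_vector_mult_minus_left)

text \<open>This is the antisymmetrized discrete product rule: the product of increments on the
  reflected side enters with a minus sign because the centred difference subtracts that side.\<close>

lemma centred_diff_mult:
  "centred_diff (\<lambda>x. f x * g x) Z =
     f (fst Z) *\<^sub>R centred_diff g Z + g (fst Z) *\<^sub>R centred_diff f Z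
     + (1/2) *\<^sub>R (prod_diff f g Z - prod_diff f g (reflect Z))"
  by (simp add: centred_diff_def prod_diff_def reflect_def vec_eq_iff field_simps)

theorem proposition4p2:
  fixes f g :: "real^'n \<Rightarrow> real"
    and dom_f dom_g :: "(real^'n) set"
    and x0 :: "real^'n" and d :: "'m::finite \<Rightarrow> real^'n"
    and X :: "('n, 'm) ordset"
  assumes X: "X = (x0, d)"
    and distinct: "card (points X) = CARD('m) + 1"
    and dom_f: "points X \<union> points (reflect X) \<subseteq> dom_f"
    and dom_g: "points X \<union> points (reflect X) \<subseteq> dom_g"
  shows "centred_simplex_grad (\<lambda>x. f x * g x) X =
           f x0 *\<^sub>R centred_simplex_grad g X + g x0 *\<^sub>R centred_simplex_grad f X
           + centred_prod_err f g X"
proof -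
  define P where "P = pinv (transpose (dir_mat X))"
  have err: "centred_prod_err f g X = (1/2) *\<^sub>R (P *v (prod_diff f g X - prod_diff f g (reflect X)))"
    unfolding centred_prod_err_def simplex_prod_err_reflect
    by (simp add: simplex_prod_err_def P_def matrix_vector_mult_diff_distrib)
  have "fst X = x0"
    by (simp add: X)
  then show ?thesis
    unfolding err centred_simplex_grad_def centred_diff_mult P_def[symmetric]
    by (simp only: matrix_vector_right_distrib matrix_vector_mult_scaleR)
qed

end
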